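(* Let $S$ and $K$ be two non-commutative subrings of a finite ring $R$ such that $S \subseteq K$, and let $p$ be the smallest prime dividing $|R|$. Then $$|E(\Gamma_{S,K})| \leq |S|\left(|K| - \frac{3|S|}{16} - p\right) - |Z(K) \cap S|\,(|K| - p).$$
   Context: Rings are associative and not assumed to have a unity. $Z(K)$ is the center of $K$. For subrings $S \subseteq K$ of a finite ring $R$, put $C_K(S) = \{k \in K : ks = sk \ \forall s \in S\}$. The generalized non-commuting graph $\Gamma_{S,K}$ (for $S \subseteq K$) is the simple graph with vertex set $K \setminus C_K(S)$ in which two distinct vertices $a, b$ are adjacent if and only if ($a \in S$ or $b \in S$) and $ab \neq ba$; $E(\Gamma_{S,K})$ is its edge set. *)

theory Defs
  imports Complex_Main "HOL-Library.Cardinality" "HOL-Computational_Algebra.Primes"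
begin

text \<open>
  Rings here need not have a unity, so the ambient ring is a type of class \<^class>\<open>ring\<close>
  (not \<open>ring_1\<close>), and subrings are not required to contain a unity either.
\<close>

definition is_subring :: "'a::ring set \<Rightarrow> bool" where
  "is_subring S \<longleftrightarrow>
     0 \<in> S \<and> (\<forall>x\<in>S. \<forall>y\<in>S. x + y \<in> S) \<and> (\<forall>x\<in>S. - x \<in> S) \<and> (\<forall>x\<in>S. \<forall>y\<in>S. x * y \<in> S)"

definition noncommutative :: "'a::ring set \<Rightarrow> bool" where
  "noncommutative S \<longleftrightarrow> (\<exists>x\<in>S. \<exists>y\<in>S. x * y \<noteq> y * x)"

definition centralizer :: "'a::ring set \<Rightarrow> 'a set \<Rightarrow> 'a set" where
  "centralizer K S = {k \<in> K. \<forall>s\<in>S. k * s = s * k}"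

definition center :: "'a::ring set \<Rightarrow> 'a set" where
  "center K = {z \<in> K. \<forall>k\<in>K. z * k = k * z}"

text \<open>The generalized non-commuting graph of \<open>S \<subseteq> K\<close>; edges are unordered pairs of vertices.\<close>

definition nc_vertices :: "'a::ring set \<Rightarrow> 'a set \<Rightarrow> 'a set" where
  "nc_vertices S K = K - centralizer K S"

definition nc_adjacent :: "'a::ring set \<Rightarrow> 'a \<Rightarrow> 'a \<Rightarrow> bool" where
  "nc_adjacent S a b \<longleftrightarrow> a \<noteq> b \<and> (a \<in> S \<or> b \<in> S) \<and> a * b \<noteq> b * a"

definition nc_edges :: "'a::ring set \<Rightarrow> 'a set \<Rightarrow> 'a set set" where
  "nc_edges S K = {{a, b} | a b. a \<in> nc_vertices S K \<and> b \<in> nc_vertices S K \<and> nc_adjacent S a b}"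

end

theory Submission
  imports Defs
begin

text \<open>
  An edge is an unordered pair of non-commuting elements \<open>a \<in> S - Z(S)\<close> and \<open>b \<in> K\<close>, and an edge
  inside \<open>S\<close> comes from two such ordered pairs. Hence \<open>|E|\<close> is at most the number of ordered pairs in
  \<open>S \<times> K\<close> minus half the number of ordered pairs in \<open>S \<times> S\<close>. The centralizer of \<open>a \<noteq> 0\<close> in \<open>K\<close> is a
  non-trivial subring, so it has at least \<open>p\<close> elements, which bounds the first number by
  \<open>(|S| - |Z(S)|) (|K| - p)\<close>. The second is at least \<open>3 |S|\<^sup>2 / 8\<close>, because the commuting probability
  of a finite non-commutative ring is at most \<open>5/8\<close>.
\<close>

lemma is_subring_diff: "is_subring S \<Longrightarrow> x \<in> S \<Longrightarrow> y \<in> S \<Longrightarrow> x - y \<in> S"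
  by (simp add: is_subring_def diff_conv_add_uminus del: add_uminus_conv_diff)

lemma is_subring_UNIV: "is_subring UNIV"
  by (simp add: is_subring_def)

lemma is_subring_centralizer:
  fixes K T :: "'a::ring set"
  shows "is_subring K \<Longrightarrow> is_subring (centralizer K T)"
proof -
  have "x * y * t = t * (x * y)" if "x * t = t * x" "y * t = t * y" for x y t :: 'a
    using that by (metis mult.assoc)
  then show "is_subring K \<Longrightarrow> is_subring (centralizer K T)"
    by (simp add: is_subring_def centralizer_def distrib_left distrib_right)
qed

text \<open>Lagrange's theorem for the additive groups: the cosets of \<open>H\<close> partition
  \<open>G\<close>, and translation is injective, so each has \<open>card H\<close>
  elements.\<close>

lemma card_subring_dvd:
  fixes H G :: "'a::ring set"
  assumes "is_subring H" "is_subring G" "H \<subseteq> G" "finite G"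
  shows "card H dvd card G"
proof -
  define coset where "coset x = (+) x ` H" for x
  have zero: "0 \<in> H"
    using assms(1) by (simp add: is_subring_def)
  have mem: "y \<in> coset x \<longleftrightarrow> y - x \<in> H" for x y
  proof
    assume "y - x \<in> H"
    then have "x + (y - x) \<in> coset x" unfolding coset_def by (rule imageI)
    then show "y \<in> coset x" by simp
  qed (auto simp: coset_def)
  have coset_eq: "coset x = coset y" if "z \<in> coset x" "z \<in> coset y" for x y z
  proof -
    have *: "coset x \<subseteq> coset y" if "z \<in> coset x" "z \<in> coset y" for x y
    proof
      fix w assume "w \<in> coset x"
      with that have "w - x \<in> H" "z - x \<in> H" "z - y \<in> H"
        by (simp_all add: mem)
      then have "w - x - (z - x) \<in> H" "z - y \<in> H"
        using is_subring_diff[OF assms(1)] by blast+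
      then have "(w - x - (z - x)) + (z - y) \<in> H"
        using assms(1) unfolding is_subring_def by blast
      then show "w \<in> coset y" by (simp add: mem)
    qed
    show ?thesis using *[OF that] *[OF that(2,1)] by blast
  qed
  have union: "\<Union>(coset ` G) = G"
  proof
    show "\<Union>(coset ` G) \<subseteq> G"
      using assms(2,3) unfolding coset_def is_subring_def by blast
    show "G \<subseteq> \<Union>(coset ` G)"
      using zero by (auto simp: mem)
  qed
  have "card H dvd card (\<Union>(coset ` G))"
  proof (rule dvd_partition)
    show "finite (\<Union>(coset ` G))" using union assms(4) by simp
    show "\<forall>c\<in>coset ` G. card H dvd card c"
      by (auto simp: coset_def card_image)
    show "\<forall>c1\<in>coset ` G. \<forall>c2\<in>coset ` G. c1 \<noteq> c2 \<longrightarrow> c1 \<inter> c2 = {}"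
      using coset_eq by blast
  qed
  with union show ?thesis by simp
qed

text \<open>By Lagrange the index is a natural number, and for a proper subring it is neither 0 nor
  1.\<close>

lemma two_card_subring_le:
  fixes H G :: "'a::ring set"
  assumes "is_subring H" "is_subring G" "H \<subset> G" "finite G"
  shows "2 * card H \<le> card G"
proof -
  obtain k where k: "card G = card H * k"
    using card_subring_dvd[of H G] assms by auto
  have "card H < card G"
    using assms(3,4) by (rule psubset_card_mono[rotated])
  with k have "2 \<le> k"
    by (cases k; cases "k - 1") auto
  then show ?thesis using k by simp
qed

text \<open>Each unordered pair in the image has at least the two preimages \<open>(a, b)\<close>
  and \<open>(b, a)\<close>, distinct by irreflexivity; summing the fibre sizes over the image gives
  \<open>card r\<close>.\<close>

lemma two_card_image_sym_irrefl_le: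
  assumes "finite r" "sym r" "irrefl r"
  shows "2 * card ((\<lambda>(a, b). {a, b}) ` r) \<le> card r"
proof -
  let ?f = "\<lambda>(a, b). {a, b}"
  have "2 \<le> card {x \<in> r. ?f x = e}" if e: "e \<in> ?f ` r" for e
  proof -
    obtain a b where ab: "(a, b) \<in> r" "e = {a, b}" using e by auto
    have "a \<noteq> b" "(b, a) \<in> r"
      using ab assms(2,3) by (auto simp: irrefl_def dest: symD)
    then have two: "card {(a, b), (b, a)} = 2" and sub: "{(a, b), (b, a)} \<subseteq> {x \<in> r. ?f x = e}"
      using ab by auto
    show ?thesis
      using card_mono[OF _ sub] two assms(1) by simp
  qed
  then have "(\<Sum>e\<in>?f ` r. 2) \<le> (\<Sum>e\<in>?f ` r. card {x \<in> r. ?f x = e})"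
    by (rule sum_mono)
  also have "\<dots> = card r"
    using sum.image_gen[OF assms(1), of "\<lambda>_. 1::nat" ?f] by simp
  finally show ?thesis by simp
qed

text \<open>At least 3/4 of the elements of \<open>S\<close> are non-central, and each of them fails
  to commute with at least half of \<open>S\<close>; the constant is 3/4 * 1/2 = 3/8.\<close>

lemma card_noncommuting_pairs_ge:
  fixes S :: "'a::ring set"
  assumes "is_subring S" "noncommutative S" "finite S"
  shows "3 * (card S)\<^sup>2 \<le> 8 * card {(a, b). a \<in> S \<and> b \<in> S \<and> a * b \<noteq> b * a}"
proof -
  let ?Z = "centralizer S S"
  have fin: "finite ?Z" "?Z \<subseteq> S" using assms(3) by (auto simp: centralizer_def)
  have half: "2 * card (centralizer S {a}) \<le> card S" if a: "a \<in> S - ?Z" for a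
  proof (intro two_card_subring_le is_subring_centralizer assms)
    obtain s where "s \<in> S" "a * s \<noteq> s * a" using a by (auto simp: centralizer_def)
    then have "s \<in> S - centralizer S {a}" by (simp add: centralizer_def)
    moreover have "centralizer S {a} \<subseteq> S" by (auto simp: centralizer_def)
    ultimately show "centralizer S {a} \<subset> S" by blast
  qed
  obtain x where x: "x \<in> S - ?Z"
    using assms(2) by (auto simp: noncommutative_def centralizer_def)
  \<comment> \<open>The inclusion of the center in the centralizer of \<open>x\<close> is proper,
    since \<open>x\<close> commutes with itself but is not central. With \<open>half\<close> this
    gives two successive proper inclusions, hence the factor 4.\<close>
  have "2 * card ?Z \<le> card (centralizer S {x})"
    using x assms(1,3)
    by (intro two_card_subring_le is_subring_centralizer) (auto simp: centralizer_def)
  with half[OF x] have quarter: "4 * card ?Z \<le> card S" by linarith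
  have "{(a, b). a \<in> S \<and> b \<in> S \<and> a * b \<noteq> b * a}
      = (SIGMA a:S - ?Z. S - centralizer S {a})"
    by (auto simp: centralizer_def)
  then have "card {(a, b). a \<in> S \<and> b \<in> S \<and> a * b \<noteq> b * a}
      = (\<Sum>a\<in>S - ?Z. card (S - centralizer S {a}))"
    using assms(3) by simp
  also have "2 * \<dots> = (\<Sum>a\<in>S - ?Z. 2 * card (S - centralizer S {a}))"
    by (rule sum_distrib_left)
  also have "\<dots> \<ge> (\<Sum>a\<in>S - ?Z. card S)"
  proof (rule sum_mono)
    fix a assume a: "a \<in> S - ?Z"
    have "card (S - centralizer S {a}) = card S - card (centralizer S {a})"
      using assms(3) by (intro card_Diff_subset) (auto simp: centralizer_def)
    with half[OF a] show "card S \<le> 2 * card (S - centralizer S {a})" by linarith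
  qed
  finally have "card (S - ?Z) * card S
      \<le> 2 * card {(a, b). a \<in> S \<and> b \<in> S \<and> a * b \<noteq> b * a}" by simp
  moreover have "3 * card S \<le> 4 * card (S - ?Z)"
    using quarter card_Diff_subset[OF fin] by linarith
  then have "3 * card S * card S \<le> 4 * card (S - ?Z) * card S"
    by (rule mult_le_mono1)
  ultimately show ?thesis unfolding power2_eq_square by linarith
qed

text \<open>Any prime factor of \<open>card H\<close> divides the order of the ambient ring by
  Lagrange, so it is at least \<open>p\<close>.\<close>

lemma prime_le_card_subring:
  fixes H :: "'a::{ring,finite} set"
  assumes "\<And>q::nat. prime q \<Longrightarrow> q dvd CARD('a) \<Longrightarrow> p \<le> q"
    and "is_subring H" "a \<in> H" "a \<noteq> 0"
  shows "p \<le> card H"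
proof -
  have "{0, a} \<subseteq> H" using assms(2,3) by (simp add: is_subring_def)
  then have "card {0, a} \<le> card H" by (intro card_mono) auto
  then have "card H \<ge> 2" using assms(4) by simp
  then obtain q where q: "prime q" "q dvd card H"
    using prime_factor_nat[of "card H"] by auto
  have "card H dvd CARD('a)"
    by (rule card_subring_dvd[OF assms(2) is_subring_UNIV]) auto
  with q have "p \<le> q" using assms(1) dvd_trans by blast
  also have "q \<le> card H" using q(2) \<open>card H \<ge> 2\<close> by (intro dvd_imp_le) auto
  finally show ?thesis .
qed

theorem proposition4p8:
  fixes S K :: "'a::{ring,finite} set" and p :: nat
  assumes "is_subring S" and "is_subring K"
    and "noncommutative S" and "noncommutative K"
    and "S \<subseteq> K"
    and "prime p" and "p dvd CARD('a)"
    and "\<And>q::nat. prime q \<Longrightarrow> q dvd CARD('a) \<Longrightarrow> p \<le> q"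
  shows "real (card (nc_edges S K))
     \<le> real (card S) * (real (card K) - 3 * real (card S) / 16 - real p)
        - real (card (center K \<inter> S)) * (real (card K) - real p)"
proof -
  let ?Z = "centralizer S S" and ?f = "\<lambda>(a, b). {a, b}"
  define A where "A = {(a, b). a \<in> S - ?Z \<and> b \<in> K \<and> a * b \<noteq> b * a}"
  define A1 where "A1 = {(a, b). a \<in> S \<and> b \<in> S \<and> a * b \<noteq> b * a}"
  have A1: "A1 \<subseteq> A"
    using assms(5) by (auto simp: A_def A1_def centralizer_def)
  have "nc_edges S K \<subseteq> ?f ` A"
  proof
    fix e assume "e \<in> nc_edges S K"
    then obtain a b where e: "e = {a, b}" "a \<in> nc_vertices S K" "b \<in> nc_vertices S K"
        "nc_adjacent S a b"
      unfolding nc_edges_def by blast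
    \<comment> \<open>The endpoint in \<open>S\<close> is non-central in \<open>S\<close> because it
      is a vertex; not commuting with the other endpoint would not suffice, as that one may lie
      outside \<open>S\<close>.\<close>
    then have "(a, b) \<in> A \<or> (b, a) \<in> A"
      by (auto simp: A_def nc_vertices_def nc_adjacent_def centralizer_def)
    with e(1) show "e \<in> ?f ` A" by (force simp: insert_commute)
  qed
  \<comment> \<open>Only pairs inside \<open>S\<close> are sure to occur in both orders, so the
    factor 1/2 is gained on \<open>A1\<close> alone.\<close>
  also have "\<dots> = ?f ` A1 \<union> ?f ` (A - A1)" using A1 by blast
  finally have "card (nc_edges S K) \<le> card (?f ` A1 \<union> ?f ` (A - A1))"
    by (intro card_mono) auto
  also have "\<dots> \<le> card (?f ` A1) + card (?f ` (A - A1))" by (rule card_Un_le)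
  also have "card (?f ` (A - A1)) \<le> card (A - A1)" by (rule card_image_le) simp
  finally have "card (nc_edges S K) \<le> card (?f ` A1) + card (A - A1)" by simp
  moreover have "card A = card A1 + card (A - A1)"
    using A1 by (simp add: card_Diff_subset card_mono)
  moreover have "2 * card (?f ` A1) \<le> card A1"
    by (rule two_card_image_sym_irrefl_le) (auto simp: A1_def sym_def irrefl_def)
  moreover have "3 * (card S)\<^sup>2 \<le> 8 * card A1"
    unfolding A1_def using assms(1,3) by (intro card_noncommuting_pairs_ge) auto
  \<comment> \<open>|E| \<le> |A1|/2 + (|A| - |A1|) = |A| - |A1|/2, and |A1|/2 is at least
    3|S|^2/16.\<close>
  ultimately have "16 * card (nc_edges S K) + 3 * (card S)\<^sup>2 \<le> 16 * card A"
    by linarith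
  then have "real (16 * card (nc_edges S K) + 3 * (card S)\<^sup>2) \<le> real (16 * card A)"
    by (rule of_nat_mono)
  then have edges: "16 * real (card (nc_edges S K)) + 3 * (real (card S))\<^sup>2 \<le> 16 * real (card A)"
    by simp
  have p_le: "p \<le> card (centralizer K {a})" if "a \<in> S - ?Z" for a
  proof (rule prime_le_card_subring[OF assms(8) is_subring_centralizer[OF assms(2)]])
    show "a \<in> centralizer K {a}" using that assms(5) by (auto simp: centralizer_def)
    show "a \<noteq> 0" using that by (auto simp: centralizer_def)
  qed
  have "A = (SIGMA a:S - ?Z. K - centralizer K {a})"
    by (auto simp: A_def centralizer_def)
  then have "card A = (\<Sum>a\<in>S - ?Z. card (K - centralizer K {a}))" by simp
  also have "\<dots> \<le> (\<Sum>a\<in>S - ?Z. card K - p)"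
  proof (rule sum_mono)
    fix a assume "a \<in> S - ?Z"
    moreover have "card (K - centralizer K {a}) = card K - card (centralizer K {a})"
      by (intro card_Diff_subset) (auto simp: centralizer_def)
    ultimately show "card (K - centralizer K {a}) \<le> card K - p"
      using p_le by (simp add: diff_le_mono2)
  qed
  \<comment> \<open>An element of \<open>S\<close> central in \<open>K\<close> is central in
    \<open>S\<close>, so passing to the smaller set \<open>center K \<inter> S\<close> only weakens
    the bound.\<close>
  also have "\<dots> \<le> (card S - card (center K \<inter> S)) * (card K - p)"
  proof -
    have "center K \<inter> S \<subseteq> ?Z"
      using assms(5) by (auto simp: center_def centralizer_def)
    then have "card (center K \<inter> S) \<le> card ?Z" by (intro card_mono) auto
    moreover have "card (S - ?Z) = card S - card ?Z"
      by (intro card_Diff_subset) (auto simp: centralizer_def)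
    ultimately show ?thesis by (simp add: diff_le_mono2)
  qed
  finally have "real (card A) \<le> real ((card S - card (center K \<inter> S)) * (card K - p))"
    by (rule of_nat_mono)
  \<comment> \<open>A non-central \<open>x\<close> yields \<open>p \<le> card K\<close>, so the
    truncated subtraction \<open>card K - p\<close> agrees with the real one.\<close>
  moreover obtain x where "x \<in> S - ?Z"
    using assms(3) by (auto simp: noncommutative_def centralizer_def)
  then have "p \<le> card K"
    by (rule order_trans[OF p_le]) (intro card_mono, auto simp: centralizer_def)
  moreover have "card (center K \<inter> S) \<le> card S"
    by (intro card_mono) auto
  ultimately have "real (card A)
      \<le> (real (card S) - real (card (center K \<inter> S))) * (real (card K) - real p)"
    by (simp add: of_nat_diff)
  with edges show ?thesis
    by (simp add: algebra_simps power2_eq_square)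
qed

end
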